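(* Let $P$ and $Q$ be nonzero orthogonal projections on $\mathbb C^n$ of the same rank $k$, $1\le k\le n$, and let $\theta\in[0,\frac{\pi}{2}]$. Then the following are equivalent: (a) $P\mathbb C^n$ and $Q\mathbb C^n$ are isoclinic subspaces at angle $\theta$; (b) $PQP=\cos(\theta)\,P$; (c) $QPQ=\cos(\theta)\,Q$.
   Context: Canonical angles. Let $\mathcal V,\mathcal W$ be finite-dimensional subspaces of a Hilbert space $\mathcal H$ and $l=\min\{\dim\mathcal V,\dim\mathcal W\}$. The canonical angles $\theta_1,\dots,\theta_l\in[0,\frac{\pi}{2}]$ between $\mathcal V$ and $\mathcal W$ are defined recursively: for $k=1,\dots,l$, $\theta_k$ is the unique number in $[0,\frac{\pi}{2}]$ with $$\cos(\theta_k)=\max\{|\langle x,y\rangle| : x\in\mathcal V\cap\{x_1,\dots,x_{k-1}\}^\perp,\ y\in\mathcal W\cap\{y_1,\dots,y_{k-1}\}^\perp,\ \|x\|=\|y\|=1\},$$ where $x_j\in\mathcal V$, $y_j\in\mathcal W$ ($j<k$) are unit vectors chosen so that the $j$-th maximum is attained at $(x_j,y_j)$ (for $k=1$ there are no orthogonality constraints). Isoclinic subspaces. Two $m$-dimensional subspaces $\mathcal V,\mathcal W$ of $\mathcal H$ ($1\le m\le\dim\mathcal H$) are isoclinic if all $m$ canonical angles between them are equal; if that angle is $\theta$, they are isoclinic at angle $\theta$.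
   Formalization: In (b) and (c) the factor cos(θ) is replaced by cos²(θ); with cos(θ) the claim fails, e.g. for two lines in C² at angle π/4, where PQP = ½P = cos(π/3)P although the lines are not isoclinic at π/3. *)

theory Defs
  imports "HOL-Analysis.Analysis"
begin

text \<open>
  The library's \<open>inner\<close> on \<open>complex ^ 'n\<close> is the real part of the Hermitian inner product below;
  both induce the library norm. Complex subspaces and complex dimension are
  \<open>vec.subspace\<close> and \<open>vec.dim\<close>.
\<close>

definition cinner :: "complex ^ 'n \<Rightarrow> complex ^ 'n \<Rightarrow> complex" where
  "cinner x y = (\<Sum>i\<in>UNIV. x $ i * cnj (y $ i))"

definition conj_transpose :: "complex ^ 'n ^ 'm \<Rightarrow> complex ^ 'm ^ 'n" where
  "conj_transpose A = (\<chi> i j. cnj (A $ j $ i))"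

definition orthogonal_projection :: "complex ^ 'n ^ 'n \<Rightarrow> bool" where
  "orthogonal_projection P \<longleftrightarrow> P ** P = P \<and> conj_transpose P = P"

definition admissible_pairs ::
  "(complex ^ 'n) set \<Rightarrow> (complex ^ 'n) set \<Rightarrow> (nat \<Rightarrow> complex ^ 'n) \<Rightarrow> (nat \<Rightarrow> complex ^ 'n) \<Rightarrow> nat
    \<Rightarrow> ((complex ^ 'n) \<times> (complex ^ 'n)) set" where
  "admissible_pairs V W x y k =
    {(u, v). u \<in> V \<and> (\<forall>j<k. cinner u (x j) = 0) \<and> v \<in> W \<and> (\<forall>j<k. cinner v (y j) = 0) \<and>
             norm u = 1 \<and> norm v = 1}"

text \<open>
  \<open>\<theta> 0, \<dots>, \<theta> (l - 1)\<close> are the canonical angles between \<open>V\<close> and \<open>W\<close>, where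
  \<open>l = min (dim V) (dim W)\<close>; the values of \<open>\<theta>\<close> at indices from \<open>l\<close> on are irrelevant.
  The sequences \<open>x\<close> and \<open>y\<close> are the maximizers chosen in the course of the recursion.
  For unit vectors \<open>x\<close>, \<open>y\<close> and the projections \<open>P\<close>, \<open>Q\<close> onto the lines they span, this gives
  \<open>P ** Q ** P = (cos (\<theta> 0))\<^sup>2 *\<^sub>R P\<close>, with the cosine squared.
\<close>

definition canonical_angles ::
  "(complex ^ 'n) set \<Rightarrow> (complex ^ 'n) set \<Rightarrow> (nat \<Rightarrow> real) \<Rightarrow> bool" where
  "canonical_angles V W \<theta> \<longleftrightarrow>
    (\<exists>x y. \<forall>k < min (vec.dim V) (vec.dim W).
       (x k, y k) \<in> admissible_pairs V W x y k \<and>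
       (\<forall>(u, v) \<in> admissible_pairs V W x y k. cmod (cinner u v) \<le> cmod (cinner (x k) (y k))) \<and>
       \<theta> k \<in> {0..pi/2} \<and> cos (\<theta> k) = cmod (cinner (x k) (y k)))"

definition isoclinic_at ::
  "(complex ^ 'n) set \<Rightarrow> (complex ^ 'n) set \<Rightarrow> real \<Rightarrow> bool" where
  "isoclinic_at V W t \<longleftrightarrow>
    vec.subspace V \<and> vec.subspace W \<and> vec.dim V = vec.dim W \<and> 1 \<le> vec.dim V \<and>
    (\<exists>\<theta>. canonical_angles V W \<theta> \<and> (\<forall>k < vec.dim V. \<theta> k = t))"

end

theory Submission
  imports Defs
begin

text \<open>
  Write \<open>V\<close> and \<open>W\<close> for the ranges of \<open>P\<close> and \<open>Q\<close>, and \<open>c = cos \<theta>\<close>. The recursion that defines the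
  canonical angles collapses when all angles agree: the first maximum is taken without
  constraints, so \<open>V\<close> and \<open>W\<close> are isoclinic at \<open>\<theta>\<close> exactly if \<open>\<bar>\<langle>u, v\<rangle>\<bar> \<le> c \<parallel>u\<parallel> \<parallel>v\<parallel>\<close> throughout \<open>V \<times> W\<close> and
  there are orthonormal bases \<open>x\<close> of \<open>V\<close> and \<open>y\<close> of \<open>W\<close> with \<open>\<bar>\<langle>x\<^sub>i, y\<^sub>i\<rangle>\<bar> = c\<close> for all \<open>i\<close>
  (lemma \<open>isoclinic_at_iff\<close>). This description is symmetric in \<open>V\<close> and \<open>W\<close>. Hence it suffices to
  show that being isoclinic is equivalent to \<open>PQP = c\<^sup>2 P\<close>; exchanging \<open>P\<close> and \<open>Q\<close> then gives the
  equivalence with \<open>QPQ = c\<^sup>2 Q\<close>.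

  If \<open>V\<close> and \<open>W\<close> are isoclinic, the bound says that \<open>Q\<close> shrinks \<open>V\<close> and \<open>P\<close> shrinks \<open>W\<close> at least by the
  factor \<open>c\<close>, while \<open>\<bar>\<langle>x\<^sub>i, y\<^sub>i\<rangle>\<bar> = c\<close> forces \<open>\<parallel>Qx\<^sub>i\<parallel> = c\<close>. Therefore
  \<open>\<parallel>PQx\<^sub>i - c\<^sup>2x\<^sub>i\<parallel>\<^sup>2 = \<parallel>PQx\<^sub>i\<parallel>\<^sup>2 - c\<^sup>4 \<le> 0\<close>, so \<open>PQ\<close> acts on the basis \<open>x\<close> as the scalar \<open>c\<^sup>2\<close>
  (lemma \<open>isoclinic_imp_compression\<close>).

  Conversely, \<open>PQP = c\<^sup>2 P\<close> makes \<open>Q\<close> multiply inner products of vectors of \<open>V\<close> by \<open>c\<^sup>2\<close>, which yields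
  the bound. For \<open>c > 0\<close> any orthonormal basis \<open>x\<close> of \<open>V\<close> is carried to the orthonormal
  system \<open>Qx\<^sub>i / c\<close>, which is a basis of \<open>W\<close> because the dimensions agree; for \<open>c = 0\<close> the two
  spaces are orthogonal and any two orthonormal bases will do
  (lemma \<open>compression_imp_isoclinic\<close>).
\<close>

section \<open>The Hermitian inner product\<close>

lemma cinner_add_left: "cinner (x + y) z = cinner x z + cinner y z"
  by (simp add: cinner_def ring_distribs sum.distrib)

lemma cinner_diff_left: "cinner (x - y) z = cinner x z - cinner y z"
  by (simp add: cinner_def ring_distribs sum_subtractf)

lemma cinner_zero_left [simp]: "cinner 0 z = 0"
  by (simp add: cinner_def)

lemma cinner_scale_left: "cinner (a *s x) z = a * cinner x z"
  by (simp add: cinner_def sum_distrib_left mult.assoc)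

lemma cinner_commute: "cinner y x = cnj (cinner x y)"
  by (simp add: cinner_def mult.commute)

lemma cmod_cinner_commute: "cmod (cinner y x) = cmod (cinner x y)"
  by (metis cinner_commute complex_mod_cnj)

lemma cinner_scale_right: "cinner x (a *s z) = cnj a * cinner x z"
  by (metis cinner_commute cinner_scale_left complex_cnj_mult)

lemma cinner_sum_left: "cinner (\<Sum>i\<in>A. f i) z = (\<Sum>i\<in>A. cinner (f i) z)"
  by (induction A rule: infinite_finite_induct) (auto simp: cinner_add_left)

lemma cinner_self: "cinner x x = complex_of_real ((norm x)\<^sup>2)"
proof -
  have "(norm x)\<^sup>2 = (\<Sum>i\<in>UNIV. (cmod (x $ i))\<^sup>2)"
    by (simp add: norm_vec_def L2_set_def sum_nonneg)
  then show ?thesis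
    by (simp only: cinner_def complex_norm_square of_real_sum)
qed

lemma Re_cinner: "Re (cinner x y) = x \<bullet> y"
  by (simp add: cinner_def inner_vec_def inner_complex_def)

lemma cmod_cinner_le: "cmod (cinner x y) \<le> norm x * norm y"
proof -
  have "cmod (cinner x y) \<le> (\<Sum>i\<in>UNIV. \<bar>cmod (x $ i)\<bar> * \<bar>cmod (y $ i)\<bar>)"
    unfolding cinner_def by (rule order_trans[OF norm_sum]) (simp add: norm_mult)
  also have "\<dots> \<le> norm x * norm y"
    unfolding norm_vec_def by (rule L2_set_mult_ineq)
  finally show ?thesis .
qed

lemma scaleR_eq_scale: "r *\<^sub>R x = complex_of_real r *s x" for x :: "complex ^ 'n"
  by (simp add: vec_eq_iff scaleR_conv_of_real[where 'a = complex])

lemma scaleR_matrix_vector_mult: "(r *\<^sub>R A) *v x = complex_of_real r *s (A *v x)"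
  for A :: "complex ^ 'n ^ 'm"
  by (simp add: vec_eq_iff matrix_vector_mult_def sum_distrib_left mult.assoc
      scaleR_conv_of_real[where 'a = complex])

lemma norm_of_real_scale: "norm (complex_of_real r *s x) = \<bar>r\<bar> * norm x" for x :: "complex ^ 'n"
  by (simp flip: scaleR_eq_scale)

section \<open>Orthonormal families\<close>

definition orthonormal_in :: "(complex ^ 'n) set \<Rightarrow> nat \<Rightarrow> (nat \<Rightarrow> complex ^ 'n) \<Rightarrow> bool" where
  "orthonormal_in V m x \<longleftrightarrow>
     (\<forall>i<m. x i \<in> V \<and> norm (x i) = 1 \<and> (\<forall>j<i. cinner (x i) (x j) = 0))"

lemma orthonormal_in_cinner:
  assumes "orthonormal_in V m x" "i < m" "j < m"
  shows "cinner (x i) (x j) = (if i = j then 1 else 0)"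
proof (cases i j rule: linorder_cases)
  case less
  then have "cinner (x j) (x i) = 0"
    using assms by (simp add: orthonormal_in_def)
  then show ?thesis
    using less cinner_commute[of "x i" "x j"] by simp
qed (use assms in \<open>auto simp: orthonormal_in_def cinner_self\<close>)

text \<open>
  Each member is nonzero and orthogonal to the span of its predecessors, so it enlarges that span.
\<close>

lemma orthonormal_in_independent:
  assumes "orthonormal_in V m x"
  shows "inj_on x {..<m} \<and> vec.independent (x ` {..<m})"
  using assms
proof (induction m)
  case 0
  then show ?case by (simp add: vec.independent_empty)
next
  case (Suc m)
  have IH: "inj_on x {..<m}" "vec.independent (x ` {..<m})"
    using Suc by (auto simp: orthonormal_in_def)
  have "vec.subspace {w. cinner w (x m) = 0}"
    by (simp add: vec.subspace_def cinner_add_left cinner_scale_left)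
  moreover have "x ` {..<m} \<subseteq> {w. cinner w (x m) = 0}"
    using orthonormal_in_cinner[OF Suc.prems] by auto
  ultimately have "vec.span (x ` {..<m}) \<subseteq> {w. cinner w (x m) = 0}"
    by (rule vec.span_minimal[rotated])
  moreover have "cinner (x m) (x m) \<noteq> 0"
    using orthonormal_in_cinner[OF Suc.prems, of m m] by simp
  ultimately have new: "x m \<notin> vec.span (x ` {..<m})"
    by blast
  then have "x m \<notin> x ` {..<m}"
    by (meson vec.span_base)
  moreover have "vec.independent (insert (x m) (x ` {..<m}))"
    using new IH(2) by (rule vec.independent_insertI)
  ultimately show ?case
    using IH(1) by (simp add: lessThan_Suc)
qed

lemma orthonormal_in_spans:
  assumes "orthonormal_in V (vec.dim V) x"
  shows "V \<subseteq> vec.span (x ` {..<vec.dim V})"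
proof (rule vec.card_ge_dim_independent)
  show "x ` {..<vec.dim V} \<subseteq> V"
    using assms by (auto simp: orthonormal_in_def)
  show "vec.independent (x ` {..<vec.dim V})" "vec.dim V \<le> card (x ` {..<vec.dim V})"
    using orthonormal_in_independent[OF assms] by (simp_all add: card_image)
qed

text \<open>
  Gram--Schmidt over the complex numbers: as long as the family is shorter than the dimension,
  some vector of \<open>V\<close> lies outside its span, and what remains of that vector after subtracting its
  projection to the span can be normalized.
\<close>

lemma exists_orthonormal_in:
  fixes V :: "(complex ^ 'n) set"
  assumes V: "vec.subspace V" and "m \<le> vec.dim V"
  shows "\<exists>x. orthonormal_in V m x"
  using assms(2)
proof (induction m)
  case 0
  then show ?case by (simp add: orthonormal_in_def)
next
  case (Suc m)
  then obtain x where x: "orthonormal_in V m x"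
    by auto
  have "\<not> V \<subseteq> vec.span (x ` {..<m})"
  proof
    assume "V \<subseteq> vec.span (x ` {..<m})"
    then have "vec.dim V \<le> card (x ` {..<m})"
      by (rule vec.dim_le_card) simp
    also have "\<dots> \<le> m"
      using card_image_le[of "{..<m}" x] by simp
    finally show False
      using Suc.prems by simp
  qed
  then obtain v where v: "v \<in> V" "v \<notin> vec.span (x ` {..<m})"
    by blast
  define p where "p = (\<Sum>j<m. cinner v (x j) *s x j)"
  define w where "w = v - p"
  have "p \<in> vec.span (x ` {..<m})"
    unfolding p_def by (intro vec.span_sum vec.span_scale vec.span_base) auto
  then have "w \<noteq> 0"
    using v(2) by (auto simp: w_def)
  have "p \<in> V"
    unfolding p_def using x
    by (intro vec.subspace_sum[OF V] vec.subspace_scale[OF V]) (auto simp: orthonormal_in_def)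
  then have "w \<in> V"
    unfolding w_def using v(1) vec.subspace_diff[OF V] by blast
  have orth: "cinner w (x j) = 0" if "j < m" for j
  proof -
    have "cinner p (x j) = (\<Sum>i<m. cinner v (x i) * (if i = j then 1 else 0))"
      unfolding p_def using that
      by (auto simp: cinner_sum_left cinner_scale_left orthonormal_in_cinner[OF x] intro!: sum.cong)
    also have "\<dots> = cinner v (x j)"
      using that by (simp add: if_distrib[of "\<lambda>t. _ * t"] cong: if_cong)
    finally show ?thesis
      by (simp add: w_def cinner_diff_left)
  qed
  define e where "e = complex_of_real (1 / norm w) *s w"
  have "e \<in> V"
    unfolding e_def using \<open>w \<in> V\<close> vec.subspace_scale[OF V] by blast
  moreover have "norm e = 1"
    unfolding e_def norm_of_real_scale using \<open>w \<noteq> 0\<close> by simp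
  moreover have "cinner e (x j) = 0" if "j < m" for j
    using orth[OF that] by (simp add: e_def cinner_scale_left)
  ultimately have "orthonormal_in V (Suc m) (x(m := e))"
    using x by (auto simp: orthonormal_in_def less_Suc_eq)
  then show ?case by blast
qed

section \<open>Isoclinic subspaces\<close>

text \<open>
  If all angles are equal, the recursive maximization needs no further care: the bound obtained
  from the first step dominates every later, more constrained maximum, and conversely any
  orthonormal bases that attain the bound in each position are valid choices of maximizers.
\<close>

lemma isoclinic_at_iff:
  "isoclinic_at V W t \<longleftrightarrow>
    vec.subspace V \<and> vec.subspace W \<and> vec.dim V = vec.dim W \<and> 1 \<le> vec.dim V \<and> t \<in> {0..pi/2} \<and>
    (\<forall>u\<in>V. \<forall>v\<in>W. cmod (cinner u v) \<le> cos t * norm u * norm v) \<and>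
    (\<exists>x y. orthonormal_in V (vec.dim V) x \<and> orthonormal_in W (vec.dim W) y \<and>
           (\<forall>i<vec.dim V. cmod (cinner (x i) (y i)) = cos t))"
  (is "_ \<longleftrightarrow> ?R")
proof
  assume iso: "isoclinic_at V W t"
  then have VW: "vec.subspace V" "vec.subspace W" "vec.dim V = vec.dim W" "1 \<le> vec.dim V"
    by (auto simp: isoclinic_at_def)
  from iso obtain \<theta> where "canonical_angles V W \<theta>" and \<theta>: "\<And>k. k < vec.dim V \<Longrightarrow> \<theta> k = t"
    by (auto simp: isoclinic_at_def)
  then obtain x y where maxima: "\<forall>k < min (vec.dim V) (vec.dim W).
       (x k, y k) \<in> admissible_pairs V W x y k \<and>
       (\<forall>(u, v) \<in> admissible_pairs V W x y k. cmod (cinner u v) \<le> cmod (cinner (x k) (y k))) \<and>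
       \<theta> k \<in> {0..pi/2} \<and> cos (\<theta> k) = cmod (cinner (x k) (y k))"
    unfolding canonical_angles_def by blast
  have xy: "(x k, y k) \<in> admissible_pairs V W x y k \<and>
      (\<forall>(u, v) \<in> admissible_pairs V W x y k. cmod (cinner u v) \<le> cmod (cinner (x k) (y k))) \<and>
      t \<in> {0..pi/2} \<and> cos t = cmod (cinner (x k) (y k))" if "k < vec.dim V" for k
    using maxima[THEN spec, of k] \<theta>[OF that] that VW(3) by simp
  have first: "0 < vec.dim V"
    using VW by simp
  \<comment> \<open>The first maximum is unconstrained, so it bounds the inner product on all of \<open>V \<times> W\<close>.\<close>
  have unit: "cmod (cinner u v) \<le> cos t" if "u \<in> V" "v \<in> W" "norm u = 1" "norm v = 1" for u v
    using xy[OF first] that by (auto simp: admissible_pairs_def)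
  have bound: "cmod (cinner u v) \<le> cos t * norm u * norm v" if "u \<in> V" "v \<in> W" for u v
  proof (cases "u = 0 \<or> v = 0")
    case True
    then show ?thesis
      using cmod_cinner_le[of u v] by auto
  next
    case False
    define a b where "a = complex_of_real (1 / norm u)" and "b = complex_of_real (1 / norm v)"
    have "cmod (cinner (a *s u) (b *s v)) \<le> cos t"
    proof (rule unit)
      show "a *s u \<in> V" "b *s v \<in> W"
        using VW that vec.subspace_scale by blast+
      show "norm (a *s u) = 1" "norm (b *s v) = 1"
        unfolding a_def b_def norm_of_real_scale using False by auto
    qed
    then show ?thesis
      using False
      by (simp add: a_def b_def cinner_scale_left cinner_scale_right norm_mult norm_divide
          field_simps)
  qed
  have "orthonormal_in V (vec.dim V) x" "orthonormal_in W (vec.dim W) y"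
    "\<forall>i<vec.dim V. cmod (cinner (x i) (y i)) = cos t" "t \<in> {0..pi/2}"
    using xy xy[OF first] VW by (auto simp: orthonormal_in_def admissible_pairs_def)
  with VW bound show ?R by blast
next
  assume R: ?R
  then obtain x y where "orthonormal_in V (vec.dim V) x" "orthonormal_in W (vec.dim W) y"
    and c: "\<And>i. i < vec.dim V \<Longrightarrow> cmod (cinner (x i) (y i)) = cos t"
    by blast
  then have "(x k, y k) \<in> admissible_pairs V W x y k" if "k < vec.dim V" for k
    using that R by (auto simp: admissible_pairs_def orthonormal_in_def)
  moreover have "cmod (cinner u v) \<le> cos t" if "(u, v) \<in> admissible_pairs V W x y k" for u v k
  proof -
    have "u \<in> V" "v \<in> W" "norm u = 1" "norm v = 1"
      using that by (auto simp: admissible_pairs_def)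
    moreover have "cmod (cinner u v) \<le> cos t * norm u * norm v"
      using R \<open>u \<in> V\<close> \<open>v \<in> W\<close> by blast
    ultimately show ?thesis by simp
  qed
  ultimately have "canonical_angles V W (\<lambda>_. t)"
    unfolding canonical_angles_def using R c by (intro exI[of _ x] exI[of _ y]) auto
  then show "isoclinic_at V W t"
    unfolding isoclinic_at_def using R by auto
qed

lemma isoclinic_at_commute:
  assumes "isoclinic_at V W t"
  shows "isoclinic_at W V t"
proof -
  have R: "vec.subspace V" "vec.subspace W" "vec.dim W = vec.dim V" "1 \<le> vec.dim V" "t \<in> {0..pi/2}"
    and bound: "\<And>u v. u \<in> V \<Longrightarrow> v \<in> W \<Longrightarrow> cmod (cinner u v) \<le> cos t * norm u * norm v"
    using assms unfolding isoclinic_at_iff by auto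
  obtain x y where "orthonormal_in V (vec.dim V) x" "orthonormal_in W (vec.dim W) y"
    and "\<forall>i<vec.dim V. cmod (cinner (x i) (y i)) = cos t"
    using assms unfolding isoclinic_at_iff by blast
  then have "\<exists>y x. orthonormal_in W (vec.dim W) y \<and> orthonormal_in V (vec.dim V) x \<and>
      (\<forall>i<vec.dim W. cmod (cinner (y i) (x i)) = cos t)"
    using R(3) cmod_cinner_commute by metis
  moreover have "cmod (cinner v u) \<le> cos t * norm v * norm u" if "u \<in> V" "v \<in> W" for u v
    using bound[OF that] cmod_cinner_commute[of u v] by (simp add: mult_ac)
  ultimately show ?thesis
    unfolding isoclinic_at_iff using R by simp
qed

section \<open>Orthogonal projections\<close>

lemma cinner_matrix_left: "cinner (A *v x) y = cinner x (conj_transpose A *v y)"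
proof -
  have "cinner (A *v x) y = (\<Sum>i\<in>UNIV. \<Sum>j\<in>UNIV. A $ i $ j * x $ j * cnj (y $ i))"
    by (simp add: cinner_def matrix_vector_mult_def sum_distrib_right)
  also have "\<dots> = (\<Sum>j\<in>UNIV. \<Sum>i\<in>UNIV. A $ i $ j * x $ j * cnj (y $ i))"
    by (rule sum.swap)
  also have "\<dots> = cinner x (conj_transpose A *v y)"
    by (simp add: cinner_def matrix_vector_mult_def conj_transpose_def sum_distrib_left mult_ac)
  finally show ?thesis .
qed

context
  fixes P :: "complex ^ 'n ^ 'n"
  assumes P: "orthogonal_projection P"
begin

lemma projection_cinner: "cinner (P *v x) y = cinner x (P *v y)"
  using P by (simp add: cinner_matrix_left orthogonal_projection_def)

lemma projection_idem: "P *v (P *v x) = P *v x"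
  using P by (simp add: matrix_vector_mul_assoc orthogonal_projection_def)

lemma projection_range: "x \<in> range ((*v) P) \<Longrightarrow> P *v x = x"
  by (auto simp: projection_idem)

lemma projection_cinner_self: "cinner x (P *v x) = complex_of_real ((norm (P *v x))\<^sup>2)"
  by (metis cinner_self projection_cinner projection_idem)

end

lemma subspace_range_matrix: "vec.subspace (range ((*v) A))" for A :: "complex ^ 'n ^ 'n"
  by (rule vec.subspace_image) (rule vec.subspace_UNIV)

definition cnj_vec :: "complex ^ 'n \<Rightarrow> complex ^ 'n" where
  "cnj_vec v = (\<chi> i. cnj (v $ i))"

lemma cnj_vec_semilinear:
  "cnj_vec 0 = 0"
  "cnj_vec (u + v) = cnj_vec u + cnj_vec v"
  "cnj_vec (a *s v) = cnj a *s cnj_vec v"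
  by (simp_all add: cnj_vec_def vec_eq_iff)

text \<open>
  Complex conjugation is only semilinear, but it still carries a spanning set to a spanning set.
\<close>

lemma vec_dim_image_cnj_vec_le: "vec.dim (cnj_vec ` S) \<le> vec.dim S"
proof -
  obtain B where B: "B \<subseteq> S" "vec.independent B" "S \<subseteq> vec.span B" "card B = vec.dim S"
    using vec.basis_exists by blast
  have "finite B"
    using B(2) by (rule vec.finiteI_independent)
  have "vec.subspace {v. cnj_vec v \<in> vec.span (cnj_vec ` B)}"
    by (auto simp: vec.subspace_def cnj_vec_semilinear vec.span_zero intro: vec.span_add vec.span_scale)
  moreover have "B \<subseteq> {v. cnj_vec v \<in> vec.span (cnj_vec ` B)}"
    by (auto intro: vec.span_base)
  ultimately have "vec.span B \<subseteq> {v. cnj_vec v \<in> vec.span (cnj_vec ` B)}"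
    by (rule vec.span_minimal[rotated])
  then have "cnj_vec ` S \<subseteq> vec.span (cnj_vec ` B)"
    using B(3) by blast
  then have "vec.dim (cnj_vec ` S) \<le> card (cnj_vec ` B)"
    using \<open>finite B\<close> by (intro vec.dim_le_card) auto
  also have "\<dots> \<le> vec.dim S"
    using card_image_le[OF \<open>finite B\<close>, of cnj_vec] B(4) by simp
  finally show ?thesis .
qed

text \<open>
  The rank is by definition the dimension of the row space. The rows of a Hermitian matrix are the
  complex conjugates of its columns, so for a projection this is also the dimension of the
  column space, which is the range.
\<close>

lemma rank_eq_dim_range:
  fixes P :: "complex ^ 'n ^ 'n"
  assumes P: "orthogonal_projection P"
  shows "rank P = vec.dim (range ((*v) P))"
proof -
  have "conj_transpose P $ i $ j = P $ i $ j" for i j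
    using P by (simp add: orthogonal_projection_def)
  then have "row i P = cnj_vec (column i P)" "column i P = cnj_vec (row i P)" for i
    by (simp_all add: row_def column_def cnj_vec_def conj_transpose_def vec_eq_iff)
  then have "rows P = cnj_vec ` columns P" "columns P = cnj_vec ` rows P"
    by (auto simp: rows_def columns_def)
  then have "vec.dim (rows P) = vec.dim (columns P)"
    using vec_dim_image_cnj_vec_le by (metis le_antisym)
  moreover have "vec.span (columns P) = range ((*v) P)"
  proof
    have "column i P = P *v axis i 1" for i
      by (simp add: matrix_vector_mult_def column_def axis_def vec_eq_iff if_distrib cong: if_cong)
    then have "columns P \<subseteq> range ((*v) P)"
      by (auto simp: columns_def)
    then show "vec.span (columns P) \<subseteq> range ((*v) P)"
      using subspace_range_matrix by (rule vec.span_minimal)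
  qed (auto intro: matrix_vector_mult_in_columnspace_gen)
  ultimately show ?thesis
    by (metis row_rank_def_gen vec.dim_span)
qed

text \<open>
  Testing the bound against \<open>v = Q *v u\<close> suffices, since \<open>cinner u (Q *v u)\<close> is the squared norm of
  \<open>Q *v u\<close>.
\<close>

lemma projection_norm_le:
  assumes Q: "orthogonal_projection Q"
    and "\<And>v. v \<in> range ((*v) Q) \<Longrightarrow> cmod (cinner u v) \<le> a * norm v" and "0 \<le> a"
  shows "norm (Q *v u) \<le> a"
proof -
  have "norm (Q *v u) * norm (Q *v u) \<le> a * norm (Q *v u)"
    using assms(2)[of "Q *v u"]
    by (simp add: projection_cinner_self[OF Q] norm_power power2_eq_square norm_mult)
  then show ?thesis
    using \<open>0 \<le> a\<close> by (cases "norm (Q *v u) = 0") auto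
qed

text \<open>
  A common bound \<open>c\<close> for \<open>Q\<close> on the range of \<open>P\<close> and for \<open>P\<close> on the range of \<open>Q\<close> is attained by \<open>Q\<close> at
  every basis vector \<open>x i\<close>. Equality in these estimates leaves \<open>P *v (Q *v x i)\<close> no choice but to be
  \<open>c\<^sup>2\<close> times \<open>x i\<close>.
\<close>

lemma isoclinic_imp_compression:
  assumes P: "orthogonal_projection P" and Q: "orthogonal_projection Q"
    and iso: "isoclinic_at (range ((*v) P)) (range ((*v) Q)) t"
  shows "P ** Q ** P = (cos t)\<^sup>2 *\<^sub>R P"
proof -
  let ?V = "range ((*v) P)" and ?W = "range ((*v) Q)"
  define c where "c = cos t"
  from iso obtain x y where t: "t \<in> {0..pi/2}"
    and bound: "\<And>u v. u \<in> ?V \<Longrightarrow> v \<in> ?W \<Longrightarrow> cmod (cinner u v) \<le> c * norm u * norm v"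
    and x: "orthonormal_in ?V (vec.dim ?V) x" and y: "orthonormal_in ?W (vec.dim ?W) y"
    and xy: "\<And>i. i < vec.dim ?V \<Longrightarrow> cmod (cinner (x i) (y i)) = c"
    and dim: "vec.dim ?V = vec.dim ?W"
    unfolding isoclinic_at_iff c_def by blast
  have "0 \<le> c"
    using t by (auto simp: c_def cos_ge_zero)
  have Q_le: "norm (Q *v u) \<le> c * norm u" if "u \<in> ?V" for u
    using bound[OF that] \<open>0 \<le> c\<close> by (intro projection_norm_le[OF Q]) auto
  have P_le: "norm (P *v w) \<le> c * norm w" if "w \<in> ?W" for w
    using bound[OF _ that] \<open>0 \<le> c\<close>
    by (intro projection_norm_le[OF P]) (auto simp: cmod_cinner_commute[of w] mult_ac)
  have eigen: "P *v (Q *v x i) = complex_of_real (c\<^sup>2) *s x i" if i: "i < vec.dim ?V" for i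
  proof -
    have xi: "x i \<in> ?V" "norm (x i) = 1" and yi: "y i \<in> ?W" "norm (y i) = 1"
      using x y i dim by (auto simp: orthonormal_in_def)
    have "c = cmod (cinner (Q *v x i) (y i))"
      by (simp add: projection_cinner[OF Q] projection_range[OF Q yi(1)] xy[OF i])
    then have "c \<le> norm (Q *v x i)"
      using cmod_cinner_le[of "Q *v x i" "y i"] yi by simp
    then have Qx: "norm (Q *v x i) = c"
      using Q_le[OF xi(1)] xi(2) by simp
    then have PQx: "norm (P *v (Q *v x i)) \<le> c\<^sup>2"
      using P_le[of "Q *v x i"] by (simp add: power2_eq_square)
    have "(P *v (Q *v x i)) \<bullet> x i = Re (cinner (Q *v x i) (x i))"
      by (metis P projection_cinner projection_range Re_cinner xi(1))
    also have "\<dots> = c\<^sup>2"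
      by (metis Q Qx projection_cinner projection_cinner_self Re_complex_of_real)
    finally have inner: "(P *v (Q *v x i)) \<bullet> x i = c\<^sup>2" .
    have "(norm (P *v (Q *v x i) - c\<^sup>2 *\<^sub>R x i))\<^sup>2
        = (norm (P *v (Q *v x i)))\<^sup>2 - 2 * (c\<^sup>2 * ((P *v (Q *v x i)) \<bullet> x i)) + (c\<^sup>2)\<^sup>2 * (norm (x i))\<^sup>2"
      unfolding power2_norm_eq_inner
      by (simp add: inner_diff inner_commute power2_eq_square algebra_simps)
    also have "\<dots> = (norm (P *v (Q *v x i)))\<^sup>2 - (c\<^sup>2)\<^sup>2"
      by (simp add: inner xi(2) power2_eq_square)
    also have "\<dots> \<le> 0"
      using power_mono[OF PQx, of 2] by simp
    finally show ?thesis
      by (simp add: scaleR_eq_scale)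
  qed
  have "P *v (Q *v v) = complex_of_real (c\<^sup>2) *s v" if "v \<in> ?V" for v
  proof -
    have "vec.subspace {v. P *v (Q *v v) = complex_of_real (c\<^sup>2) *s v}"
      by (simp add: vec.subspace_def vec.scale_right_distrib matrix_vector_right_distrib
          vector_scalar_commute vec.scale_left_commute)
    moreover have "x ` {..<vec.dim ?V} \<subseteq> {v. P *v (Q *v v) = complex_of_real (c\<^sup>2) *s v}"
      using eigen by auto
    ultimately show ?thesis
      using vec.span_minimal orthonormal_in_spans[OF x] that by blast
  qed
  then have "(P ** Q ** P) *v z = ((cos t)\<^sup>2 *\<^sub>R P) *v z" for z
    by (simp add: scaleR_matrix_vector_mult c_def flip: matrix_vector_mul_assoc)
  then show ?thesis
    by (simp add: matrix_eq)
qed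

text \<open>
  On the range of \<open>P\<close> the map \<open>Q\<close> is \<open>c\<close> times an isometry. This gives the uniform bound at once, and
  for \<open>c \<noteq> 0\<close> it transports an orthonormal basis of the range of \<open>P\<close> to one of the range of \<open>Q\<close>.
\<close>

lemma compression_imp_isoclinic:
  assumes P: "orthogonal_projection P" and Q: "orthogonal_projection Q"
    and "rank P = rank Q" and "1 \<le> rank P" and t: "t \<in> {0..pi/2}"
    and PQP: "P ** Q ** P = (cos t)\<^sup>2 *\<^sub>R P"
  shows "isoclinic_at (range ((*v) P)) (range ((*v) Q)) t"
proof -
  let ?V = "range ((*v) P)" and ?W = "range ((*v) Q)"
  have dim: "vec.dim ?V = vec.dim ?W" "1 \<le> vec.dim ?V"
    using assms(3,4) unfolding rank_eq_dim_range[OF P] rank_eq_dim_range[OF Q] .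
  define c where "c = cos t"
  have "0 \<le> c"
    using t by (auto simp: c_def cos_ge_zero)
  have PQ: "P *v (Q *v u) = complex_of_real (c\<^sup>2) *s u" if "u \<in> ?V" for u
  proof -
    have "P *v (Q *v u) = (P ** Q ** P) *v u"
      by (simp add: projection_range[OF P that] flip: matrix_vector_mul_assoc)
    also have "\<dots> = complex_of_real (c\<^sup>2) *s u"
      by (simp add: PQP c_def scaleR_matrix_vector_mult projection_range[OF P that])
    finally show ?thesis .
  qed
  have QQ: "cinner (Q *v u) (Q *v v) = complex_of_real (c\<^sup>2) * cinner u v"
    if "u \<in> ?V" "v \<in> ?V" for u v
  proof -
    have "cinner (Q *v u) (Q *v v) = cinner (Q *v u) (P *v v)"
      by (metis P Q projection_cinner projection_idem projection_range that(2))
    also have "\<dots> = cinner (P *v (Q *v u)) v"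
      by (simp add: projection_cinner[OF P])
    finally show ?thesis
      by (simp add: PQ[OF that(1)] cinner_scale_left)
  qed
  have normQ: "norm (Q *v u) = c * norm u" if "u \<in> ?V" for u
  proof -
    have "(norm (Q *v u))\<^sup>2 = (c * norm u)\<^sup>2"
      using QQ[OF that that] unfolding cinner_self
      by (metis of_real_eq_iff of_real_mult power_mult_distrib)
    then show ?thesis
      using \<open>0 \<le> c\<close> by simp
  qed
  have bound: "cmod (cinner u v) \<le> c * norm u * norm v" if "u \<in> ?V" "v \<in> ?W" for u v
  proof -
    have "cinner u v = cinner (Q *v u) v"
      by (simp only: projection_cinner[OF Q] projection_range[OF Q that(2)])
    then show ?thesis
      using cmod_cinner_le[of "Q *v u" v] by (simp only: normQ[OF that(1)])
  qed
  obtain x where x: "orthonormal_in ?V (vec.dim ?V) x"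
    using exists_orthonormal_in[OF subspace_range_matrix] by blast
  then have xV: "x i \<in> ?V" "norm (x i) = 1" if "i < vec.dim ?V" for i
    using that unfolding orthonormal_in_def by blast+
  have "\<exists>y. orthonormal_in ?W (vec.dim ?W) y \<and> (\<forall>i<vec.dim ?V. cmod (cinner (x i) (y i)) = c)"
  proof (cases "c = 0")
    case True
    \<comment> \<open>\<open>Q\<close> annihilates \<open>?V\<close>, so \<open>x\<close> gives no basis of \<open>?W\<close>; by the bound, any basis works.\<close>
    obtain y where y: "orthonormal_in ?W (vec.dim ?W) y"
      using exists_orthonormal_in[OF subspace_range_matrix] by blast
    have "cmod (cinner (x i) (y i)) = c" if "i < vec.dim ?V" for i
    proof -
      have "y i \<in> ?W"
        using y that dim(1) unfolding orthonormal_in_def by metis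
      then show ?thesis
        using bound[OF xV(1)[OF that]] True by fastforce
    qed
    with y show ?thesis by blast
  next
    case False
    define y where "y = (\<lambda>i. complex_of_real (1 / c) *s (Q *v x i))"
    have "y i \<in> ?W" for i
      unfolding y_def using vec.subspace_scale[OF subspace_range_matrix] by blast
    moreover have "norm (y i) = 1" if "i < vec.dim ?V" for i
      unfolding y_def norm_of_real_scale normQ[OF xV(1)[OF that]] using False \<open>0 \<le> c\<close> xV(2)[OF that]
      by simp
    moreover have "cinner (y i) (y j) = 0" if "i < vec.dim ?V" "j < i" for i j
    proof -
      have "cinner (x i) (x j) = 0"
        using x that unfolding orthonormal_in_def by blast
      moreover have "j < vec.dim ?V"
        using that by linarith
      ultimately show ?thesis
        by (simp only: y_def cinner_scale_left cinner_scale_right QQ[OF xV(1) xV(1)] that mult_zero_right)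
    qed
    ultimately have "orthonormal_in ?W (vec.dim ?W) y"
      unfolding orthonormal_in_def dim(1)[symmetric] by blast
    moreover have "cmod (cinner (x i) (y i)) = c" if "i < vec.dim ?V" for i
    proof -
      have "cinner (x i) (y i) = complex_of_real (1 / c) * complex_of_real (c\<^sup>2)"
        unfolding y_def cinner_scale_right projection_cinner_self[OF Q] normQ[OF xV(1)[OF that]]
        by (simp add: xV(2)[OF that])
      then have "cinner (x i) (y i) = complex_of_real c"
        using False by (simp add: power2_eq_square)
      then show ?thesis
        using \<open>0 \<le> c\<close> by simp
    qed
    ultimately show ?thesis by blast
  qed
  then obtain y where "orthonormal_in ?W (vec.dim ?W) y"
    "\<forall>i<vec.dim ?V. cmod (cinner (x i) (y i)) = c"
    by blast
  then show ?thesis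
    unfolding isoclinic_at_iff
    using subspace_range_matrix dim t bound x unfolding c_def by blast
qed

theorem proposition10:
  fixes P Q :: "complex ^ 'n ^ 'n" and k :: nat and \<theta> :: real
  assumes "orthogonal_projection P" and "orthogonal_projection Q"
    and "P \<noteq> 0" and "Q \<noteq> 0"
    and "rank P = k" and "rank Q = k" and "1 \<le> k" and "k \<le> CARD('n)"
    and "\<theta> \<in> {0..pi/2}"
  shows "(isoclinic_at (range ((*v) P)) (range ((*v) Q)) \<theta> \<longleftrightarrow> P ** Q ** P = (cos \<theta>)\<^sup>2 *\<^sub>R P) \<and>
         (P ** Q ** P = (cos \<theta>)\<^sup>2 *\<^sub>R P \<longleftrightarrow> Q ** P ** Q = (cos \<theta>)\<^sup>2 *\<^sub>R Q)"
proof -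
  have iff: "isoclinic_at (range ((*v) A)) (range ((*v) B)) \<theta> \<longleftrightarrow> A ** B ** A = (cos \<theta>)\<^sup>2 *\<^sub>R A"
    if "orthogonal_projection A" "orthogonal_projection B" "rank A = k" "rank B = k"
    for A B :: "complex ^ 'n ^ 'n"
    using isoclinic_imp_compression compression_imp_isoclinic that assms(7,9) by metis
  show ?thesis
    using iff[of P Q] iff[of Q P] assms isoclinic_at_commute by blast
qed

end
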